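(* Let $\mathcal{X}=\mathbb{R}^{d'}$ and $\mathcal{Y}=\mathbb{R}^d$ with $d,d'\ge1$. For $p\ge1$, $\nu\in\mathcal{P}_p(\mathcal{Y})$ and a Markov kernel $\rho:\mathcal{X}\to\mathcal{P}(\mathcal{Y})$, let $\mathscr{A}$ be the set of minimizers of $\sigma\mapsto W_p^p(\nu_\sigma,\nu)$ over $\mathcal{P}(\mathcal{X})$, and consider the conditions (CTY) $x\mapsto\rho_x$ is continuous in the narrow topology; (CRC) $x\mapsto M_p(\rho_x)$ has totally bounded sublevel sets; (INJ) $\sigma\mapsto\nu_\sigma$ is injective on $\mathscr{A}$; (feasibility) $\inf_{\sigma\in\mathcal{P}(\mathcal{X})}W_p^p(\nu_\sigma,\nu)<+\infty$. Then: (i) Suppose $p=2$. There exist $\nu\in\mathcal{P}_2(\mathcal{Y})$, not satisfying $\nu\ll\mathcal{L}^d$, and a Markov kernel $\rho$ such that (CTY), (CRC), (INJ) and feasibility hold, and for which minimizers are not unique (i.e. $\mathscr{A}$ has more than one element). (ii) Suppose $p=1$. There exist $\nu\in\mathcal{P}_1(\mathcal{Y})$ with $\nu\ll\mathcal{L}^d$ and a Markov kernel $\rho$ such that (CTY), (CRC), (INJ) and feasibility hold, and for which minimizers are not unique.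
   Context: $\mathcal{X}=\mathbb{R}^{d'}$ carries the Euclidean metric. $\mathcal{P}(\cdot)$ denotes Borel probability measures; $\mathcal{L}^d$ is Lebesgue measure on $\mathbb{R}^d$. $M_p(\mu)=\int|y|^p\,d\mu(y)\in[0,\infty]$ and $\mathcal{P}_p(\mathcal{Y})=\{\mu\in\mathcal{P}(\mathcal{Y}):M_p(\mu)<\infty\}$. A Markov kernel $\rho:\mathcal{X}\to\mathcal{P}(\mathcal{Y})$, $x\mapsto\rho_x$, is a map such that $x\mapsto\rho_x(B)$ is Borel measurable for every Borel $B\subseteq\mathcal{Y}$. For $\sigma\in\mathcal{P}(\mathcal{X})$, $\nu_\sigma\in\mathcal{P}(\mathcal{Y})$ is defined by $\int f\,d\nu_\sigma=\int_{\mathcal{X}}\left(\int_{\mathcal{Y}}f(y)\,d\rho_x(y)\right)d\sigma(x)$ for all $f\in C_b(\mathcal{Y})$. $W_p^p(\mu_1,\mu_2)=\inf_\Gamma\int|y'-y|^p\,d\Gamma(y',y)\in[0,\infty]$, the infimum over couplings of $\mu_1,\mu_2$. Narrow topology: convergence against bounded continuous functions. *)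

theory Defs
  imports "HOL-Probability.Probability"
begin

abbreviation borel_probs :: "'a::euclidean_space measure set" where
  "borel_probs \<equiv> space (prob_algebra borel)"

definition moment :: "real \<Rightarrow> 'a::euclidean_space measure \<Rightarrow> ennreal" where
  "moment p \<mu> = (\<integral>\<^sup>+ y. ennreal (norm y powr p) \<partial>\<mu>)"

definition borel_probs_moment :: "real \<Rightarrow> 'a::euclidean_space measure set" where
  "borel_probs_moment p = {\<mu> \<in> borel_probs. moment p \<mu> < \<infinity>}"

definition couplings ::
  "'a::euclidean_space measure \<Rightarrow> 'a measure \<Rightarrow> ('a \<times> 'a) measure set" where
  "couplings \<mu>1 \<mu>2 =
     {\<Gamma> \<in> borel_probs. distr \<Gamma> borel fst = \<mu>1 \<and> distr \<Gamma> borel snd = \<mu>2}"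

text \<open>The \<open>p\<close>-th power \<open>W\<^sub>p\<^sup>p\<close> of the Wasserstein distance, with value in \<open>[0, \<infinity>]\<close>.\<close>

definition wasserstein_powr ::
  "real \<Rightarrow> 'a::euclidean_space measure \<Rightarrow> 'a measure \<Rightarrow> ennreal" where
  "wasserstein_powr p \<mu>1 \<mu>2 =
     (INF \<Gamma> \<in> couplings \<mu>1 \<mu>2. \<integral>\<^sup>+ (y', y). ennreal (norm (y' - y) powr p) \<partial>\<Gamma>)"

definition markov_kernel ::
  "('x::euclidean_space \<Rightarrow> 'y::euclidean_space measure) \<Rightarrow> bool" where
  "markov_kernel \<rho> \<longleftrightarrow>
     (\<forall>x. \<rho> x \<in> borel_probs) \<and>
     (\<forall>B \<in> sets borel. (\<lambda>x. measure (\<rho> x) B) \<in> borel_measurable borel)"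

lemma markov_kernel_iff_measurable:
  "markov_kernel \<rho> \<longleftrightarrow> \<rho> \<in> borel \<rightarrow>\<^sub>M prob_algebra borel"
proof
  assume k: "markov_kernel \<rho>"
  have p: "prob_space (\<rho> x)" and s: "sets (\<rho> x) = sets borel" for x
    using k by (auto simp: markov_kernel_def space_prob_algebra)
  show "\<rho> \<in> borel \<rightarrow>\<^sub>M prob_algebra borel"
  proof (intro measurable_prob_algebraI measurable_subprob_algebra)
    fix B :: "'b set" assume B: "B \<in> sets borel"
    have "(\<lambda>x. emeasure (\<rho> x) B) = (\<lambda>x. ennreal (measure (\<rho> x) B))"
    proof
      fix x
      interpret prob_space "\<rho> x" by (rule p)
      show "emeasure (\<rho> x) B = ennreal (measure (\<rho> x) B)" by (rule emeasure_eq_measure)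
    qed
    then show "(\<lambda>x. emeasure (\<rho> x) B) \<in> borel_measurable borel"
      using k B by (simp add: markov_kernel_def)
  qed (use p s in \<open>auto intro: prob_space_imp_subprob_space\<close>)
next
  assume "\<rho> \<in> borel \<rightarrow>\<^sub>M prob_algebra borel"
  then show "markov_kernel \<rho>"
    unfolding markov_kernel_def
    using measurable_space[of \<rho> borel "prob_algebra borel"]
      measurable_compose[OF _ measurable_measure_prob_algebra] by fastforce
qed

text \<open>
  The measure \<open>\<nu>\<^sub>\<sigma>\<close> is the bind of the Giry monad; \<open>mixture_eq_iff\<close> below shows that it is
  the unique Borel probability measure with
  \<open>\<integral> f d\<nu>\<^sub>\<sigma> = \<integral> (\<integral> f d\<rho>\<^sub>x) d\<sigma>(x)\<close> for all bounded continuous \<open>f\<close>.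
\<close>

definition mixture ::
  "('x::euclidean_space \<Rightarrow> 'y::euclidean_space measure) \<Rightarrow> 'x measure \<Rightarrow> 'y measure" where
  "mixture \<rho> \<sigma> = \<sigma> \<bind> \<rho>"

lemma mixture_in_borel_probs:
  assumes "markov_kernel \<rho>" "\<sigma> \<in> borel_probs"
  shows "mixture \<rho> \<sigma> \<in> borel_probs"
proof -
  have "\<rho> \<in> borel \<rightarrow>\<^sub>M prob_algebra borel"
    using assms(1) by (simp add: markov_kernel_iff_measurable)
  from prob_space_bind'[OF assms(2) this] sets_bind'[OF assms(2) this] show ?thesis
    by (simp add: mixture_def space_prob_algebra)
qed

lemma integral_mixture:
  fixes f :: "'y::euclidean_space \<Rightarrow>\<^sub>C real"
  assumes "markov_kernel \<rho>" "\<sigma> \<in> borel_probs"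
  shows "(\<integral> y. f y \<partial>mixture \<rho> \<sigma>) = (\<integral> x. (\<integral> y. f y \<partial>\<rho> x) \<partial>\<sigma>)"
proof -
  have s: "sets \<sigma> = sets borel" and "prob_space \<sigma>"
    using assms(2) by (auto simp: space_prob_algebra)
  interpret prob_space \<sigma> by fact
  have m: "\<rho> \<in> \<sigma> \<rightarrow>\<^sub>M subprob_algebra borel"
    unfolding measurable_cong_sets[OF s refl]
    using assms(1)[unfolded markov_kernel_iff_measurable] by (rule measurable_prob_algebraD)
  have f: "continuous_on UNIV f" "bounded (range f)"
    using apply_bcontfun[of f] by (auto simp: bcontfun_def)
  obtain B where B: "\<And>y. norm (f y) \<le> B"
    using f(2) by (auto simp: bounded_iff)
  show ?thesis unfolding mixture_def
  proof (rule integral_bind[where K = borel and B = B and B' = 1])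
    show "apply_bcontfun f \<in> borel_measurable borel"
      using f(1) by (rule borel_measurable_continuous_onI)
    show "AE x in \<sigma>. emeasure (\<rho> x) (space (\<rho> x)) \<le> ennreal 1"
      using assms(1)
      by (auto simp: markov_kernel_def space_prob_algebra prob_space.emeasure_space_1)
  qed (use m B finite_measure_axioms in auto)
qed

lemma borel_probs_eqI:
  fixes \<mu> \<nu> :: "'y::euclidean_space measure"
  assumes \<mu>: "\<mu> \<in> borel_probs" and \<nu>: "\<nu> \<in> borel_probs"
    and eq: "\<And>f :: 'y \<Rightarrow>\<^sub>C real. (\<integral> y. f y \<partial>\<mu>) = (\<integral> y. f y \<partial>\<nu>)"
  shows "\<mu> = \<nu>"
proof -
  have s: "sets \<mu> = sets borel" "sets \<nu> = sets borel" and p: "prob_space \<mu>" "prob_space \<nu>"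
    using \<mu> \<nu> by (auto simp: space_prob_algebra)
  interpret M: prob_space \<mu> by (fact p(1))
  interpret N: prob_space \<nu> by (fact p(2))
  have closed_eq: "measure \<mu> S = measure \<nu> S" if S: "closed S" "S \<noteq> {}" for S
  proof -
    define g where "g n x = max 0 (1 - real n * infdist x S)" for n x
    have cont: "continuous_on UNIV (g n)" for n
      unfolding g_def by (intro continuous_intros)
    have bnd: "norm (g n x) \<le> 1" for n x
      by (auto simp: g_def infdist_nonneg)
    have lim: "(\<lambda>n. g n x) \<longlonglongrightarrow> indicator S x" for x
    proof (cases "x \<in> S")
      case True
      then show ?thesis by (simp add: g_def)
    next
      case False
      then have pos: "infdist x S > 0"
        using S infdist_pos_not_in_closed by blast
      obtain n0 :: nat where n0: "1 < real n0 * infdist x S"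
        using pos reals_Archimedean3 by blast
      have "g n x = 0" if "n \<ge> n0" for n
      proof -
        have "real n0 * infdist x S \<le> real n * infdist x S"
          using that pos by (intro mult_right_mono) auto
        then show ?thesis using n0 by (auto simp: g_def)
      qed
      then have "eventually (\<lambda>n. g n x = 0) sequentially"
        by (auto simp: eventually_sequentially)
      then show ?thesis using False by (simp add: tendsto_eventually)
    qed
    have conv: "(\<lambda>n. \<integral> y. g n y \<partial>\<kappa>) \<longlonglongrightarrow> measure \<kappa> S"
      if k: "prob_space \<kappa>" "sets \<kappa> = sets borel" for \<kappa>
    proof -
      interpret K: prob_space \<kappa> by (fact k(1))
      have "(\<lambda>n. \<integral> y. g n y \<partial>\<kappa>) \<longlonglongrightarrow> (\<integral> y. indicator S y \<partial>\<kappa>)"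
      proof (rule integral_dominated_convergence[where w = "\<lambda>_. 1"])
        show "(indicator S :: 'y \<Rightarrow> real) \<in> borel_measurable \<kappa>"
          unfolding measurable_cong_sets[OF k(2) refl]
          using S(1) by (intro borel_measurable_indicator borel_closed)
        show "g n \<in> borel_measurable \<kappa>" for n
          unfolding measurable_cong_sets[OF k(2) refl]
          by (rule borel_measurable_continuous_onI[OF cont])
      qed (use lim bnd in auto)
      moreover have "S \<inter> space \<kappa> = S"
        using sets_eq_imp_space_eq[OF k(2)] by simp
      ultimately show ?thesis by simp
    qed
    have "(\<integral> y. g n y \<partial>\<mu>) = (\<integral> y. g n y \<partial>\<nu>)" for n
    proof -
      have "g n \<in> bcontfun" using cont bnd by (rule bcontfun_normI)
      then show ?thesis using eq[of "Bcontfun (g n)"] by (simp add: Bcontfun_inverse)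
    qed
    then show ?thesis
      using conv[OF p(1) s(1)] conv[OF p(2) s(2)] LIMSEQ_unique by auto
  qed
  show ?thesis
  proof (rule measure_eqI_generator_eq[where E = "Collect closed" and \<Omega> = UNIV and A = "\<lambda>_. UNIV"])
    show "emeasure \<mu> X = emeasure \<nu> X" if "X \<in> Collect closed" for X
      using closed_eq[of X] that
      by (cases "X = {}") (auto simp: M.emeasure_eq_measure N.emeasure_eq_measure)
    show "sets \<mu> = sigma_sets UNIV (Collect closed)"
      using s(1) by (simp add: borel_eq_closed)
    show "sets \<nu> = sigma_sets UNIV (Collect closed)"
      using s(2) by (simp add: borel_eq_closed)
  qed (auto simp: Int_stable_def)
qed

lemma mixture_eq_iff:
  fixes \<rho> :: "'x::euclidean_space \<Rightarrow> 'y::euclidean_space measure"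
  assumes "markov_kernel \<rho>" "\<sigma> \<in> borel_probs" "\<mu> \<in> borel_probs"
  shows "\<mu> = mixture \<rho> \<sigma> \<longleftrightarrow>
    (\<forall>f :: 'y \<Rightarrow>\<^sub>C real. (\<integral> y. f y \<partial>\<mu>) = (\<integral> x. (\<integral> y. f y \<partial>\<rho> x) \<partial>\<sigma>))"
  using assms borel_probs_eqI[OF assms(3) mixture_in_borel_probs[OF assms(1,2)]]
  by (auto simp: integral_mixture)

text \<open>
  The narrow topology on Borel probability measures is the initial topology of the maps
  \<open>\<mu> \<mapsto> \<integral> f d\<mu>\<close>, where \<open>f\<close> ranges over the bounded continuous functions; the function
  space \<open>('a \<Rightarrow>\<^sub>C real) \<Rightarrow> real\<close> carries the product topology.
\<close>

definition narrow_topology :: "'a::euclidean_space measure topology" where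
  "narrow_topology =
     pullback_topology borel_probs (\<lambda>\<mu> (f :: 'a \<Rightarrow>\<^sub>C real). \<integral> y. f y \<partial>\<mu>) euclidean"

definition narrowly_continuous ::
  "('x::euclidean_space \<Rightarrow> 'y::euclidean_space measure) \<Rightarrow> bool" where
  "narrowly_continuous \<rho> \<longleftrightarrow> continuous_map euclidean narrow_topology \<rho>"

lemma narrowly_continuous_iff:
  fixes \<rho> :: "'x::euclidean_space \<Rightarrow> 'y::euclidean_space measure"
  shows "narrowly_continuous \<rho> \<longleftrightarrow>
    (\<forall>x. \<rho> x \<in> borel_probs) \<and>
    (\<forall>f :: 'y \<Rightarrow>\<^sub>C real. continuous_on UNIV (\<lambda>x. \<integral> y. f y \<partial>\<rho> x))"
    (is "?L \<longleftrightarrow> ?P \<and> ?R")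
proof -
  let ?I = "\<lambda>\<mu> (f :: 'y \<Rightarrow>\<^sub>C real). \<integral> y. f y \<partial>\<mu>"
  have R: "?R \<longleftrightarrow> continuous_map euclidean euclidean (?I \<circ> \<rho>)"
    by (auto simp: comp_def intro!: continuous_on_coordinatewise_then_product
        dest: continuous_on_product_then_coordinatewise)
  show ?thesis
  proof
    assume L: ?L
    then have "\<rho> \<in> UNIV \<rightarrow> borel_probs"
      by (auto simp: narrowly_continuous_def narrow_topology_def continuous_map_def
          topspace_pullback_topology)
    moreover have "continuous_map euclidean euclidean ((id \<circ> ?I) \<circ> \<rho>)"
      using L unfolding narrowly_continuous_def narrow_topology_def
      by (rule continuous_map_compose) (rule continuous_map_pullback, simp)
    ultimately show "?P \<and> ?R"
      unfolding R by auto
  next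
    assume "?P \<and> ?R"
    then show ?L
      unfolding R narrowly_continuous_def narrow_topology_def
      by (intro continuous_map_pullback') auto
  qed
qed

definition minimizers ::
  "real \<Rightarrow> 'y::euclidean_space measure \<Rightarrow> ('x::euclidean_space \<Rightarrow> 'y measure) \<Rightarrow> 'x measure set" where
  "minimizers p \<nu> \<rho> =
     {\<sigma>. is_arg_min (\<lambda>\<sigma>. wasserstein_powr p (mixture \<rho> \<sigma>) \<nu>) (\<lambda>\<sigma>. \<sigma> \<in> borel_probs) \<sigma>}"

definition moment_coercive ::
  "real \<Rightarrow> ('x::euclidean_space \<Rightarrow> 'y::euclidean_space measure) \<Rightarrow> bool" where
  "moment_coercive p \<rho> \<longleftrightarrow> (\<forall>c < \<infinity>. totally_bounded {x. moment p (\<rho> x) \<le> c})"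

definition injective_on_minimizers ::
  "real \<Rightarrow> 'y::euclidean_space measure \<Rightarrow> ('x::euclidean_space \<Rightarrow> 'y measure) \<Rightarrow> bool" where
  "injective_on_minimizers p \<nu> \<rho> \<longleftrightarrow> inj_on (mixture \<rho>) (minimizers p \<nu> \<rho>)"

definition feasible ::
  "real \<Rightarrow> 'y::euclidean_space measure \<Rightarrow> ('x::euclidean_space \<Rightarrow> 'y measure) \<Rightarrow> bool" where
  "feasible p \<nu> \<rho> \<longleftrightarrow>
     (INF \<sigma> \<in> borel_probs. wasserstein_powr p (mixture \<rho> \<sigma>) \<nu>) < \<infinity>"

end

theory Submission
  imports Defs
begin

text \<open>
  Let \<open>\<rho>\<^sub>x\<close> be the law of \<open>Y + S e\<close>, where \<open>Y\<close> has law \<open>\<nu>\<close>, \<open>e\<close> is a fixed unit vector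
  and \<open>S \<ge> 0\<close> is a random displacement whose \<open>p\<close>-th moment is \<open>c(x) = 1 + |x| |x - u|\<close>.
  The coupling that undoes the displacement gives \<open>W\<^sub>p\<^sup>p(\<nu>\<^sub>\<sigma>, \<nu>) \<le> \<integral> c d\<sigma>\<close>.  The converse inequality
  follows from a Kantorovich potential \<open>\<phi>\<close>: for \<open>p = 1\<close> and \<open>\<nu>\<close> uniform on the unit cube take
  \<open>\<phi>(y) = y \<bullet> e\<close>, and for \<open>p = 2\<close> and \<open>\<nu> = \<delta>\<^sub>0\<close> take \<open>\<phi>(y) = |y|\<^sup>2\<close>.  So the functional is affine
  in \<open>\<sigma>\<close>, and its minimizers are all probability measures carried by the two minimum points
  \<open>0\<close> and \<open>u\<close> of \<open>c\<close>.  They are told apart by the mass that \<open>\<nu>\<^sub>\<sigma>\<close> gives to \<open>{y. y \<bullet> e < 1}\<close>,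
  which is null for \<open>\<rho>\<^sub>0\<close> but not for \<open>\<rho>\<^sub>u\<close>.
\<close>

section \<open>Total boundedness and weak Kantorovich duality\<close>

lemma totally_bounded_bounded:
  fixes S :: "'a::euclidean_space set"
  assumes "bounded S"
  shows "totally_bounded S"
proof -
  have "compact (closure S)"
    using assms by simp
  then have "totally_bounded (closure S)"
    unfolding compact_eq_totally_bounded totally_bounded_metric ball_def by blast
  then show ?thesis
    using closure_subset by (rule totally_bounded_subset)
qed

text \<open>The easy half of Kantorovich duality: integrate the pointwise inequality against an
  arbitrary coupling. Since it holds for every \<open>y'\<close> and almost every \<open>y\<close>,
  it transfers to the coupling through the second marginal alone. The sum form avoids truncated
  subtraction in \<open>ennreal\<close>.\<close>

lemma wasserstein_powr_ge:
  fixes \<phi> \<psi> :: "'a::euclidean_space \<Rightarrow> ennreal"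
  assumes \<phi>[measurable]: "\<phi> \<in> borel_measurable borel" and \<psi>[measurable]: "\<psi> \<in> borel_measurable borel"
    and le: "AE y in \<nu>. \<forall>y'. \<phi> y' \<le> ennreal (norm (y' - y) powr p) + \<psi> y"
  shows "(\<integral>\<^sup>+y. \<phi> y \<partial>\<mu>) \<le> wasserstein_powr p \<mu> \<nu> + (\<integral>\<^sup>+y. \<psi> y \<partial>\<nu>)"
proof -
  have *: "(\<integral>\<^sup>+y. \<phi> y \<partial>\<mu>) \<le> (\<integral>\<^sup>+(y', y). ennreal (norm (y' - y) powr p) \<partial>\<Gamma>) + (\<integral>\<^sup>+y. \<psi> y \<partial>\<nu>)"
    if "\<Gamma> \<in> couplings \<mu> \<nu>" for \<Gamma>
  proof -
    have sets[measurable_cong]: "sets \<Gamma> = sets (borel \<Otimes>\<^sub>M borel)"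
      using that unfolding couplings_def borel_prod by (simp add: space_prob_algebra)
    have \<mu>: "\<mu> = distr \<Gamma> borel fst" and \<nu>: "\<nu> = distr \<Gamma> borel snd"
      using that by (auto simp: couplings_def)
    have "AE z in \<Gamma>. \<forall>y'. \<phi> y' \<le> ennreal (norm (y' - snd z) powr p) + \<psi> (snd z)"
      using le unfolding \<nu> by (intro AE_distrD[of snd \<Gamma> borel]) auto
    then have "(\<integral>\<^sup>+z. \<phi> (fst z) \<partial>\<Gamma>) \<le> (\<integral>\<^sup>+z. ennreal (norm (fst z - snd z) powr p) + \<psi> (snd z) \<partial>\<Gamma>)"
      by (intro nn_integral_mono_AE) auto
    also have "\<dots> = (\<integral>\<^sup>+z. ennreal (norm (fst z - snd z) powr p) \<partial>\<Gamma>) + (\<integral>\<^sup>+z. \<psi> (snd z) \<partial>\<Gamma>)"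
      by (intro nn_integral_add) auto
    finally show ?thesis
      unfolding \<mu> \<nu> by (simp add: nn_integral_distr split_beta')
  qed
  show ?thesis
  \<comment> \<open>An infinite \<open>\<psi>\<close>-integral makes the bound trivial. A finite one
    can be moved to the left, leaving a constant lower bound for the infimum over couplings.\<close>
  proof (cases "(\<integral>\<^sup>+y. \<psi> y \<partial>\<nu>) = \<top>")
    case False
    then have "(\<integral>\<^sup>+y. \<phi> y \<partial>\<mu>) - (\<integral>\<^sup>+y. \<psi> y \<partial>\<nu>) \<le> wasserstein_powr p \<mu> \<nu>"
      unfolding wasserstein_powr_def using *
      by (intro INF_greatest) (simp add: ennreal_minus_le_iff add.commute)
    then show ?thesis
      using False by (simp add: ennreal_minus_le_iff add.commute)
  qed simp
qed

text \<open>This isolates what both examples share. \<open>\<phi>_diff\<close> makes the pair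
  \<open>\<phi>\<close>, \<open>\<phi>\<close> admissible in the dual problem, and
  \<open>\<phi>_shift\<close> makes it tight for displacements along \<open>e\<close>.
  \<open>\<phi>_le\<close> ties the potential to the moment, and \<open>\<nu>_slab\<close> serves to
  tell the two extreme kernels apart.\<close>

locale displaced_noise =
  fixes p :: real and \<nu> :: "'y::euclidean_space measure" and e :: 'y and \<phi> :: "'y \<Rightarrow> ennreal"
    and u :: "'x::euclidean_space"
  assumes p_pos: "0 < p"
    and norm_e: "norm e = 1"
    and norm_u: "norm u = 1"
    and \<nu>_moment: "\<nu> \<in> borel_probs_moment p"
    and \<nu>_slab: "AE y in \<nu>. 0 \<le> y \<bullet> e \<and> y \<bullet> e < 1"
    and \<phi>_borel[measurable]: "\<phi> \<in> borel_measurable borel"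
    and \<phi>_le: "\<phi> y \<le> ennreal (norm y powr p)"
    and \<phi>_diff: "AE y in \<nu>. \<forall>y'. \<phi> y' \<le> ennreal (norm (y' - y) powr p) + \<phi> y"
    and \<phi>_shift: "AE y in \<nu>. \<forall>s\<ge>0. \<phi> (y + s *\<^sub>R e) = \<phi> y + ennreal (s powr p)"
begin

section \<open>Cost, noise and the displaced kernel\<close>

definition cost :: "'x \<Rightarrow> real" where
  "cost x = 1 + norm x * norm (x - u)"

text \<open>The cap at 1 keeps both coin weights in \<open>shift\<close> nonnegative. The extreme
  values 0 and 1 are taken at \<open>0\<close> and at \<open>u\<close>.\<close>

definition spread :: "'x \<Rightarrow> real" where
  "spread x = min 1 (norm x)"

text \<open>
  The two outcomes of the coin are weighted so that the \<open>p\<close>-th power of the displacement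
  has mean \<open>cost x\<close> whatever the spread; the spread only serves to make the kernels
  at the two minimum points of the cost different.
\<close>

definition shift :: "'x \<Rightarrow> bool \<Rightarrow> real" where
  "shift x b = (cost x * (if b then 1 + spread x else 1 - spread x)) powr (1 / p)"

text \<open>A single probability space for all \<open>x\<close>: every kernel is a pushforward of
  it, so dependence on \<open>x\<close> is governed by the map \<open>displaced\<close>
  alone.\<close>

definition noise :: "('y \<times> bool) measure" where
  "noise = \<nu> \<Otimes>\<^sub>M measure_pmf (bernoulli_pmf (1 / 2))"

definition displaced :: "'x \<Rightarrow> 'y \<times> bool \<Rightarrow> 'y" where
  "displaced x \<omega> = fst \<omega> + shift x (snd \<omega>) *\<^sub>R e"

definition kernel :: "'x \<Rightarrow> 'y measure" where
  "kernel x = distr noise borel (displaced x)"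

lemma sets_\<nu>[measurable_cong, simp]: "sets \<nu> = sets borel"
  and prob_space_\<nu>: "prob_space \<nu>"
  and moment_\<nu>: "moment p \<nu> < \<infinity>"
  using \<nu>_moment by (auto simp: borel_probs_moment_def space_prob_algebra)

lemma space_\<nu>[simp]: "space \<nu> = UNIV"
  using sets_eq_imp_space_eq[OF sets_\<nu>] by simp

lemma prob_space_noise: "prob_space noise"
  unfolding noise_def by (intro prob_space_pair prob_space_\<nu> prob_space_measure_pmf)

lemma sets_noise[measurable_cong]: "sets noise = sets (borel \<Otimes>\<^sub>M count_space UNIV)"
  unfolding noise_def by (intro sets_pair_measure_cong) auto

lemma distr_noise_fst: "distr noise \<nu> fst = \<nu>"
  unfolding noise_def by (rule prob_space.distr_pair_fst[OF prob_space_measure_pmf])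

lemma nn_integral_noise_fst:
  assumes [measurable]: "f \<in> borel_measurable borel"
  shows "(\<integral>\<^sup>+\<omega>. f (fst \<omega>) \<partial>noise) = (\<integral>\<^sup>+y. f y \<partial>\<nu>)"
  by (subst distr_noise_fst[symmetric], subst nn_integral_distr) auto

lemma nn_integral_noise_snd:
  "(\<integral>\<^sup>+\<omega>. f (snd \<omega>) \<partial>noise) = (f True + f False) * ennreal (1 / 2)"
proof -
  have "(\<integral>\<^sup>+\<omega>. f (snd \<omega>) \<partial>noise) = (\<integral>\<^sup>+y. \<integral>\<^sup>+b. f b \<partial>measure_pmf (bernoulli_pmf (1 / 2)) \<partial>\<nu>)"
    unfolding noise_def
    by (subst sigma_finite_measure.nn_integral_fst[symmetric])
      (auto intro: prob_space_imp_sigma_finite prob_space_measure_pmf)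
  then show ?thesis
    using prob_space.emeasure_space_1[OF prob_space_\<nu>]
    by (simp add: distrib_right)
qed

lemma AE_noise:
  assumes "AE y in \<nu>. P y"
  shows "AE \<omega> in noise. P (fst \<omega>)"
  by (rule AE_distrD[where M' = \<nu>], measurable) (subst distr_noise_fst, rule assms)

lemma cost_ge_1: "1 \<le> cost x"
  by (simp add: cost_def)

lemma cost_eq_1_iff: "cost x = 1 \<longleftrightarrow> x = 0 \<or> x = u"
  by (auto simp: cost_def)

lemma spread_bounds: "0 \<le> spread x" "spread x \<le> 1"
  by (auto simp: spread_def)

lemma shift_nonneg: "0 \<le> shift x b"
  by (simp add: shift_def)

lemma shift_powr: "shift x b powr p = cost x * (if b then 1 + spread x else 1 - spread x)"
proof -
  have "0 \<le> cost x * (if b then 1 + spread x else 1 - spread x)"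
    using cost_ge_1[of x] spread_bounds[of x] by auto
  then show ?thesis
    using p_pos by (simp add: shift_def powr_powr)
qed

lemma continuous_shift: "continuous_on UNIV (\<lambda>x. shift x b)"
proof -
  \<comment> \<open>The base vanishes for \<open>b = False\<close> once
    \<open>norm x \<ge> 1\<close>; continuity of \<open>powr\<close> there rests on the positive
    exponent \<open>1 / p\<close>.\<close>
  have "\<forall>x\<in>UNIV. 0 \<le> cost x * (if b then 1 + spread x else 1 - spread x)
    \<and> (cost x * (if b then 1 + spread x else 1 - spread x) = 0 \<longrightarrow> 0 < 1 / p)"
    using order_trans[OF zero_le_one cost_ge_1] spread_bounds p_pos by simp
  moreover have "continuous_on UNIV (\<lambda>x. cost x * (if b then 1 + spread x else 1 - spread x))"
    unfolding cost_def spread_def by (cases b) (auto intro!: continuous_intros)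
  ultimately show ?thesis
    unfolding shift_def by (intro continuous_on_powr' continuous_on_const) auto
qed

lemma measurable_shift[measurable]:
  "(\<lambda>(x, b). shift x b) \<in> borel_measurable (borel \<Otimes>\<^sub>M count_space UNIV)"
  unfolding shift_def cost_def spread_def by measurable

lemma measurable_displaced[measurable]:
  "(\<lambda>(x, \<omega>). displaced x \<omega>) \<in> borel_measurable (borel \<Otimes>\<^sub>M (borel \<Otimes>\<^sub>M count_space UNIV))"
  unfolding displaced_def by measurable

lemma measurable_displaced'[measurable]: "displaced x \<in> borel_measurable noise"
  by measurable

lemma nn_integral_shift: "(\<integral>\<^sup>+\<omega>. ennreal (shift x (snd \<omega>) powr p) \<partial>noise) = ennreal (cost x)"
proof -
  have "(\<integral>\<^sup>+\<omega>. ennreal (shift x (snd \<omega>) powr p) \<partial>noise)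
    = (ennreal (cost x * (1 + spread x)) + ennreal (cost x * (1 - spread x))) * ennreal (1 / 2)"
    by (subst nn_integral_noise_snd) (simp add: shift_powr)
  also have "\<dots> = ennreal ((cost x * (1 + spread x) + cost x * (1 - spread x)) * (1 / 2))"
    using cost_ge_1[of x] spread_bounds[of x] by (simp add: ennreal_plus ennreal_mult del: times_divide_eq_right)
  also have "(cost x * (1 + spread x) + cost x * (1 - spread x)) * (1 / 2) = cost x"
    by (simp add: field_simps)
  finally show ?thesis .
qed

section \<open>Integrals of the potential against the kernel\<close>

lemma nn_integral_kernel:
  assumes [measurable]: "f \<in> borel_measurable borel"
  shows "(\<integral>\<^sup>+y. f y \<partial>kernel x) = (\<integral>\<^sup>+\<omega>. f (displaced x \<omega>) \<partial>noise)"
  unfolding kernel_def by (intro nn_integral_distr) auto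

text \<open>The equality case of duality: by \<open>\<phi>_shift\<close> the potential gains exactly
  the \<open>p\<close>-th power of the displacement, whose mean is \<open>cost x\<close>.\<close>

lemma nn_integral_\<phi>_kernel: "(\<integral>\<^sup>+y. \<phi> y \<partial>kernel x) = ennreal (cost x) + (\<integral>\<^sup>+y. \<phi> y \<partial>\<nu>)"
proof -
  have "(\<integral>\<^sup>+y. \<phi> y \<partial>kernel x) = (\<integral>\<^sup>+\<omega>. \<phi> (displaced x \<omega>) \<partial>noise)"
    by (intro nn_integral_kernel) measurable
  also have "\<dots> = (\<integral>\<^sup>+\<omega>. ennreal (shift x (snd \<omega>) powr p) + \<phi> (fst \<omega>) \<partial>noise)"
    by (intro nn_integral_cong_AE)
      (use AE_noise[OF \<phi>_shift] in eventually_elim,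
        simp add: displaced_def shift_nonneg add.commute)
  also have "\<dots> = (\<integral>\<^sup>+\<omega>. ennreal (shift x (snd \<omega>) powr p) \<partial>noise) + (\<integral>\<^sup>+\<omega>. \<phi> (fst \<omega>) \<partial>noise)"
    by (intro nn_integral_add) auto
  finally show ?thesis
    by (simp add: nn_integral_shift nn_integral_noise_fst)
qed

text \<open>Finiteness is what later allows this integral to be cancelled from both sides of the
  duality bound.\<close>

lemma nn_integral_\<phi>_finite: "(\<integral>\<^sup>+y. \<phi> y \<partial>\<nu>) < \<infinity>"
proof -
  have "(\<integral>\<^sup>+y. \<phi> y \<partial>\<nu>) \<le> moment p \<nu>"
    unfolding moment_def by (intro nn_integral_mono \<phi>_le)
  then show ?thesis
    using moment_\<nu> by simp
qed

section \<open>Measurability, narrow continuity and coercivity of the kernel\<close>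

lemma kernel_measurable: "kernel \<in> borel \<rightarrow>\<^sub>M prob_algebra borel"
proof (rule measurable_prob_algebraI)
  show "prob_space (kernel x)" for x
    unfolding kernel_def by (intro prob_space.prob_space_distr prob_space_noise) measurable
  \<comment> \<open>The measure being pushed forward does not depend on \<open>x\<close>, so
    membership in the subprobability algebra and joint measurability of \<open>displaced\<close>
    suffice.\<close>
  have "noise \<in> space (subprob_algebra (borel \<Otimes>\<^sub>M count_space UNIV))"
    by (simp add: space_subprob_algebra sets_noise prob_space_imp_subprob_space prob_space_noise)
  then show "kernel \<in> borel \<rightarrow>\<^sub>M subprob_algebra borel"
    unfolding kernel_def
    by (intro measurable_distr2[where M = "borel \<Otimes>\<^sub>M count_space UNIV"]) measurable
qed

lemma markov_kernel_kernel: "markov_kernel kernel"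
  by (simp add: markov_kernel_iff_measurable kernel_measurable)

lemma kernel_measurable_subprob:
  assumes "\<sigma> \<in> borel_probs"
  shows "kernel \<in> \<sigma> \<rightarrow>\<^sub>M subprob_algebra borel"
  using measurable_prob_algebraD[OF kernel_measurable] assms
  by (simp add: space_prob_algebra cong: measurable_cong_sets)

lemma nn_integral_mixture_kernel:
  assumes "\<sigma> \<in> borel_probs" "f \<in> borel_measurable borel"
  shows "(\<integral>\<^sup>+y. f y \<partial>mixture kernel \<sigma>) = (\<integral>\<^sup>+x. \<integral>\<^sup>+y. f y \<partial>kernel x \<partial>\<sigma>)"
  unfolding mixture_def
  by (rule nn_integral_bind[OF assms(2) kernel_measurable_subprob[OF assms(1)]])

text \<open>Dominated convergence on \<open>noise\<close>: for each fixed outcome the displaced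
  point depends continuously on \<open>x\<close>, and the test function is bounded.\<close>

lemma narrowly_continuous_kernel: "narrowly_continuous kernel"
  unfolding narrowly_continuous_iff
proof (intro conjI allI)
  show "kernel x \<in> borel_probs" for x
    using markov_kernel_kernel by (simp add: markov_kernel_def)
  fix f :: "'y \<Rightarrow>\<^sub>C real"
  interpret N: prob_space noise by (rule prob_space_noise)
  have cont: "continuous_on UNIV f" and "bounded (range f)"
    using apply_bcontfun[of f] by (auto simp: bcontfun_def)
  then obtain B where B: "\<And>y. norm (f y) \<le> B"
    by (auto simp: bounded_iff)
  have [measurable]: "apply_bcontfun f \<in> borel_measurable borel"
    using cont by (rule borel_measurable_continuous_onI)
  have "(\<lambda>n. \<integral>\<omega>. f (displaced (X n) \<omega>) \<partial>noise) \<longlonglongrightarrow> (\<integral>\<omega>. f (displaced x \<omega>) \<partial>noise)"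
    if X: "X \<longlonglongrightarrow> x" for X :: "nat \<Rightarrow> 'x" and x
  proof (rule integral_dominated_convergence[where w = "\<lambda>_. B"])
    have "(\<lambda>n. f (displaced (X n) \<omega>)) \<longlonglongrightarrow> f (displaced x \<omega>)" for \<omega>
    proof -
      have "(\<lambda>n. shift (X n) (snd \<omega>)) \<longlonglongrightarrow> shift x (snd \<omega>)"
        using continuous_shift X by (auto simp: continuous_on_sequentially comp_def)
      then have "(\<lambda>n. displaced (X n) \<omega>) \<longlonglongrightarrow> displaced x \<omega>"
        unfolding displaced_def by (intro tendsto_intros)
      then show ?thesis
        using cont by (auto simp: continuous_on_sequentially comp_def)
    qed
    then show "AE \<omega> in noise. (\<lambda>n. f (displaced (X n) \<omega>)) \<longlonglongrightarrow> f (displaced x \<omega>)"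
      by simp
  qed (use B in auto)
  then show "continuous_on UNIV (\<lambda>x. \<integral>y. f y \<partial>kernel x)"
    by (auto simp: continuous_on_sequentially comp_def kernel_def integral_distr)
qed

lemma moment_coercive_kernel: "moment_coercive p kernel"
  unfolding moment_coercive_def
proof (intro allI impI totally_bounded_bounded)
  fix c :: ennreal
  assume "c < \<infinity>"
  then obtain r where c: "c = ennreal r" "0 \<le> r"
    by (cases c) auto
  have "norm x \<le> r + 1" if "moment p (kernel x) \<le> c" for x
  proof -
    have "ennreal (cost x) \<le> (\<integral>\<^sup>+y. \<phi> y \<partial>kernel x)"
      by (simp add: nn_integral_\<phi>_kernel)
    also have "\<dots> \<le> moment p (kernel x)"
      unfolding moment_def by (intro nn_integral_mono \<phi>_le)
    finally have "cost x \<le> r"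
      using that c by (metis ennreal_le_iff order_trans)
    moreover have "norm x - 1 \<le> norm (x - u)"
      using norm_triangle_ineq2[of x u] norm_u by simp
    \<comment> \<open>Outside the unit ball \<open>norm x * norm (x - u) \<ge> norm x - 1\<close>,
      so \<open>cost x \<ge> norm x\<close>; inside it \<open>0 \<le> r\<close> is enough.\<close>
    ultimately show ?thesis
      using c(2) mult_mono[of 1 "norm x" "norm x - 1" "norm (x - u)"]
      by (cases "norm x \<le> 1") (auto simp: cost_def)
  qed
  then show "bounded {x. moment p (kernel x) \<le> c}"
    by (auto simp: bounded_iff)
qed

section \<open>Closed form of the transport functional\<close>

lemma wasserstein_mixture:
  assumes \<sigma>: "\<sigma> \<in> borel_probs"
  shows "wasserstein_powr p (mixture kernel \<sigma>) \<nu> = (\<integral>\<^sup>+x. ennreal (cost x) \<partial>\<sigma>)"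
proof (rule antisym)
  have sets_\<sigma>[measurable_cong]: "sets \<sigma> = sets borel" and prob_\<sigma>: "prob_space \<sigma>"
    using \<sigma> by (auto simp: space_prob_algebra)
  have ne: "space \<sigma> \<noteq> {}"
    using prob_\<sigma> by (rule prob_space.not_empty)
  have [measurable]: "cost \<in> borel_measurable borel"
    unfolding cost_def by measurable

  \<comment> \<open>The joint law of a displaced point and its origin couples
    \<open>kernel x\<close> with \<open>\<nu>\<close>; mixing these laws over
    \<open>\<sigma>\<close> gives the coupling for the upper bound.\<close>
  define joint where "joint x = distr noise (borel \<Otimes>\<^sub>M borel) (\<lambda>\<omega>. (displaced x \<omega>, fst \<omega>))" for x
  have joint_measurable: "joint \<in> borel \<rightarrow>\<^sub>M prob_algebra (borel \<Otimes>\<^sub>M borel)"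
  proof (rule measurable_prob_algebraI)
    show "prob_space (joint x)" for x
      unfolding joint_def by (intro prob_space.prob_space_distr prob_space_noise) measurable
    have "noise \<in> space (subprob_algebra (borel \<Otimes>\<^sub>M count_space UNIV))"
      by (simp add: space_subprob_algebra sets_noise prob_space_imp_subprob_space prob_space_noise)
    then show "joint \<in> borel \<rightarrow>\<^sub>M subprob_algebra (borel \<Otimes>\<^sub>M borel)"
      unfolding joint_def
      by (intro measurable_distr2[where M = "borel \<Otimes>\<^sub>M count_space UNIV"]) measurable
  qed
  have joint_subprob: "joint \<in> \<sigma> \<rightarrow>\<^sub>M subprob_algebra (borel \<Otimes>\<^sub>M borel)"
    using measurable_prob_algebraD[OF joint_measurable] sets_\<sigma> by (simp cong: measurable_cong_sets)

  define \<Gamma> where "\<Gamma> = \<sigma> \<bind> joint"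
  have "\<Gamma> \<in> borel_probs"
    unfolding \<Gamma>_def using prob_space_bind'[OF \<sigma> joint_measurable] sets_bind'[OF \<sigma> joint_measurable]
    unfolding borel_prod by (simp add: space_prob_algebra)
  moreover have "distr \<Gamma> borel fst = mixture kernel \<sigma>"
    unfolding \<Gamma>_def mixture_def distr_bind[OF joint_subprob ne measurable_fst]
    by (simp add: joint_def kernel_def[abs_def] distr_distr comp_def)
  \<comment> \<open>The origin has law \<open>\<nu>\<close> whatever \<open>x\<close> is, so the
    second marginal is the bind of a constant kernel.\<close>
  moreover have "distr \<Gamma> borel snd = \<nu>"
  proof -
    have "distr (joint x) borel snd = \<nu>" for x
      unfolding joint_def using distr_noise_fst
      by (simp add: distr_distr comp_def cong: distr_cong)
    then show ?thesis
      unfolding \<Gamma>_def distr_bind[OF joint_subprob ne measurable_snd]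
      by (simp add: bind_const'[OF prob_\<sigma> prob_space_imp_subprob_space[OF prob_space_\<nu>]])
  qed
  ultimately have "\<Gamma> \<in> couplings (mixture kernel \<sigma>) \<nu>"
    by (simp add: couplings_def)
  then have "wasserstein_powr p (mixture kernel \<sigma>) \<nu> \<le> (\<integral>\<^sup>+(y', y). ennreal (norm (y' - y) powr p) \<partial>\<Gamma>)"
    unfolding wasserstein_powr_def by (rule INF_lower)
  also have "\<dots> = (\<integral>\<^sup>+x. \<integral>\<^sup>+(y', y). ennreal (norm (y' - y) powr p) \<partial>joint x \<partial>\<sigma>)"
    unfolding \<Gamma>_def by (rule nn_integral_bind[OF _ joint_subprob]) measurable
  also have "\<dots> = (\<integral>\<^sup>+x. \<integral>\<^sup>+\<omega>. ennreal (shift x (snd \<omega>) powr p) \<partial>noise \<partial>\<sigma>)"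
    unfolding joint_def
    by (subst nn_integral_distr) (auto simp: displaced_def norm_e shift_nonneg)
  finally show "wasserstein_powr p (mixture kernel \<sigma>) \<nu> \<le> (\<integral>\<^sup>+x. ennreal (cost x) \<partial>\<sigma>)"
    by (simp add: nn_integral_shift)

  \<comment> \<open>Since \<open>\<sigma>\<close> has mass 1, the constant
    \<open>\<phi>\<close>-integral can be carried under it, which yields the
    \<open>\<phi>\<close>-integral of the mixture.\<close>
  have "(\<integral>\<^sup>+x. ennreal (cost x) \<partial>\<sigma>) + (\<integral>\<^sup>+y. \<phi> y \<partial>\<nu>) = (\<integral>\<^sup>+x. ennreal (cost x) + (\<integral>\<^sup>+y. \<phi> y \<partial>\<nu>) \<partial>\<sigma>)"
    using prob_space.emeasure_space_1[OF prob_\<sigma>] by (subst nn_integral_add) auto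
  also have "\<dots> = (\<integral>\<^sup>+y. \<phi> y \<partial>mixture kernel \<sigma>)"
    by (simp add: nn_integral_mixture_kernel[OF \<sigma>] nn_integral_\<phi>_kernel)
  also have "\<dots> \<le> wasserstein_powr p (mixture kernel \<sigma>) \<nu> + (\<integral>\<^sup>+y. \<phi> y \<partial>\<nu>)"
    by (rule wasserstein_powr_ge[OF \<phi>_borel \<phi>_borel \<phi>_diff])
  finally show "(\<integral>\<^sup>+x. ennreal (cost x) \<partial>\<sigma>) \<le> wasserstein_powr p (mixture kernel \<sigma>) \<nu>"
    using nn_integral_\<phi>_finite
    by (auto simp: add.commute[of _ "\<integral>\<^sup>+y. \<phi> y \<partial>\<nu>"] ennreal_add_left_cancel_le)
qed

section \<open>Minimizers of the functional\<close>

lemma wasserstein_mixture_return: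
  assumes "x = 0 \<or> x = u"
  shows "wasserstein_powr p (mixture kernel (return borel x)) \<nu> = 1"
proof -
  have "return borel x \<in> borel_probs"
    by (simp add: space_prob_algebra prob_space_return)
  moreover have "cost \<in> borel_measurable borel"
    unfolding cost_def by measurable
  ultimately show ?thesis
    using assms cost_eq_1_iff[of x] by (simp add: wasserstein_mixture nn_integral_return)
qed

lemma wasserstein_mixture_ge_1:
  assumes "\<sigma> \<in> borel_probs"
  shows "1 \<le> wasserstein_powr p (mixture kernel \<sigma>) \<nu>"
proof -
  have "1 = (\<integral>\<^sup>+x. 1 \<partial>\<sigma>)"
    using assms by (simp add: space_prob_algebra prob_space.emeasure_space_1)
  also have "\<dots> \<le> (\<integral>\<^sup>+x. ennreal (cost x) \<partial>\<sigma>)"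
    by (intro nn_integral_mono) (simp add: cost_ge_1)
  finally show ?thesis
    using assms by (simp add: wasserstein_mixture)
qed

lemma return_in_minimizers:
  assumes "x = 0 \<or> x = u"
  shows "return borel x \<in> minimizers p \<nu> kernel"
  using assms wasserstein_mixture_ge_1
  by (auto simp: minimizers_def is_arg_min_def wasserstein_mixture_return space_prob_algebra
      prob_space_return not_less)

text \<open>Comparison with the Dirac mass at \<open>0\<close> bounds the value by 1, so the
  nonnegative excess \<open>cost x - 1\<close> has integral zero and vanishes almost
  everywhere.\<close>

lemma minimizers_AE:
  assumes "\<sigma> \<in> minimizers p \<nu> kernel"
  shows "AE x in \<sigma>. x = 0 \<or> x = u"
proof -
  have \<sigma>: "\<sigma> \<in> borel_probs"
    using assms by (simp add: minimizers_def is_arg_min_def)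
  then have [measurable_cong]: "sets \<sigma> = sets borel" and prob_\<sigma>: "prob_space \<sigma>"
    by (auto simp: space_prob_algebra)
  have "return borel 0 \<in> (borel_probs :: 'x measure set)"
    by (simp add: space_prob_algebra prob_space_return)
  then have "wasserstein_powr p (mixture kernel \<sigma>) \<nu> \<le> 1"
    using assms wasserstein_mixture_return[of 0]
    by (fastforce simp: minimizers_def is_arg_min_def not_less)
  moreover have "wasserstein_powr p (mixture kernel \<sigma>) \<nu>
    = (\<integral>\<^sup>+x. 1 + ennreal (norm x * norm (x - u)) \<partial>\<sigma>)"
    unfolding wasserstein_mixture[OF \<sigma>] cost_def by (simp add: ennreal_plus)
  moreover have "\<dots> = 1 + (\<integral>\<^sup>+x. ennreal (norm x * norm (x - u)) \<partial>\<sigma>)"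
    using prob_space.emeasure_space_1[OF prob_\<sigma>] by (subst nn_integral_add) auto
  ultimately have "1 + (\<integral>\<^sup>+x. ennreal (norm x * norm (x - u)) \<partial>\<sigma>) \<le> 1 + 0"
    by simp
  then have "(\<integral>\<^sup>+x. ennreal (norm x * norm (x - u)) \<partial>\<sigma>) = 0"
    by (subst (asm) ennreal_add_left_cancel_le) auto
  then have "AE x in \<sigma>. ennreal (norm x * norm (x - u)) = 0"
    by (subst (asm) nn_integral_0_iff_AE) auto
  then show ?thesis
    by eventually_elim (auto simp: ennreal_eq_0_iff mult_le_0_iff)
qed

text \<open>A minimizer is thereby encoded by two numbers, its masses at the distinct points
  \<open>0\<close> and \<open>u\<close>.\<close>

lemma nn_integral_minimizer:
  assumes "\<sigma> \<in> minimizers p \<nu> kernel" and f: "f \<in> borel_measurable borel"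
  shows "(\<integral>\<^sup>+x. f x \<partial>\<sigma>) = f 0 * emeasure \<sigma> {0} + f u * emeasure \<sigma> {u}"
proof -
  have [measurable_cong]: "sets \<sigma> = sets borel"
    using assms by (simp add: minimizers_def is_arg_min_def space_prob_algebra)
  note f[measurable]
  have "u \<noteq> 0"
    using norm_u by auto
  have "(\<integral>\<^sup>+x. f x \<partial>\<sigma>) = (\<integral>\<^sup>+x. f 0 * indicator {0} x + f u * indicator {u} x \<partial>\<sigma>)"
    by (intro nn_integral_cong_AE)
      (use minimizers_AE[OF assms(1)] in eventually_elim, use \<open>u \<noteq> 0\<close> in auto)
  also have "\<dots> = f 0 * emeasure \<sigma> {0} + f u * emeasure \<sigma> {u}"
    by (subst nn_integral_add) (auto simp: nn_integral_cmult_indicator)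
  finally show ?thesis .
qed

section \<open>Half-space masses and injectivity\<close>

lemma kernel_0_slab: "emeasure (kernel 0) {y. y \<bullet> e < 1} = 0"
proof -
  have "emeasure (kernel 0) {y. y \<bullet> e < 1} = (\<integral>\<^sup>+y. indicator {y. y \<bullet> e < 1} y \<partial>kernel 0)"
    by (subst nn_integral_indicator) (auto simp: kernel_def)
  also have "\<dots> = (\<integral>\<^sup>+\<omega>. indicator {y. y \<bullet> e < 1} (displaced 0 \<omega>) \<partial>noise)"
    by (intro nn_integral_kernel) measurable
  \<comment> \<open>At \<open>0\<close> the cost is 1 and the spread 0, so both coin outcomes
    displace by exactly 1 and \<open>y \<bullet> e \<ge> 0\<close> becomes at least 1.\<close>
  also have "\<dots> = (\<integral>\<^sup>+\<omega>. 0 \<partial>noise)"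
    by (intro nn_integral_cong_AE)
      (use AE_noise[OF \<nu>_slab] in eventually_elim,
        use norm_e in \<open>auto simp: displaced_def shift_def cost_def spread_def inner_add_left
          norm_eq_1\<close>)
  finally show ?thesis by simp
qed

text \<open>At \<open>u\<close> the spread is 1, so the outcome \<open>False\<close>, of probability
  one half, leaves the point where it was, inside the slab.\<close>

lemma kernel_u_slab: "0 < emeasure (kernel u) {y. y \<bullet> e < 1}"
proof -
  have "0 < (\<integral>\<^sup>+\<omega>. indicator {False} (snd \<omega>) \<partial>noise)"
    by (subst nn_integral_noise_snd) (simp del: ennreal_half)
  also have "\<dots> \<le> (\<integral>\<^sup>+\<omega>. indicator {y. y \<bullet> e < 1} (displaced u \<omega>) \<partial>noise)"
    by (intro nn_integral_mono_AE)
      (use AE_noise[OF \<nu>_slab] in eventually_elim,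
        use norm_u p_pos in \<open>auto simp: displaced_def shift_def cost_def spread_def
          split: split_indicator\<close>)
  also have "\<dots> = (\<integral>\<^sup>+y. indicator {y. y \<bullet> e < 1} y \<partial>kernel u)"
    by (intro nn_integral_kernel[symmetric]) measurable
  also have "\<dots> = emeasure (kernel u) {y. y \<bullet> e < 1}"
    by (subst nn_integral_indicator) (auto simp: kernel_def)
  finally show ?thesis .
qed

text \<open>The half-space mass of the mixture determines the mass at \<open>u\<close>, total mass 1
  then determines the mass at \<open>0\<close>, and these two masses determine the
  minimizer.\<close>

lemma injective_on_minimizers_kernel: "injective_on_minimizers p \<nu> kernel"
  unfolding injective_on_minimizers_def
proof (rule inj_onI)
  fix \<sigma> \<tau> :: "'x measure"
  assume \<sigma>: "\<sigma> \<in> minimizers p \<nu> kernel" and \<tau>: "\<tau> \<in> minimizers p \<nu> kernel"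
    and eq: "mixture kernel \<sigma> = mixture kernel \<tau>"
  let ?A = "{y. y \<bullet> e < 1}"
  have A[measurable]: "?A \<in> sets borel"
    by measurable
  have mass_u: "emeasure (kernel u) ?A * emeasure \<kappa> {u} = emeasure (mixture kernel \<kappa>) ?A"
    if \<kappa>: "\<kappa> \<in> minimizers p \<nu> kernel" for \<kappa>
  proof -
    have \<kappa>': "\<kappa> \<in> borel_probs"
      using \<kappa> by (simp add: minimizers_def is_arg_min_def)
    have "(\<lambda>x. emeasure (kernel x) ?A) \<in> borel_measurable borel"
      using measurable_prob_algebraD[OF kernel_measurable] by (rule measurable_emeasure_kernel) simp
    then have "(\<integral>\<^sup>+x. emeasure (kernel x) ?A \<partial>\<kappa>) = emeasure (kernel u) ?A * emeasure \<kappa> {u}"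
      by (simp add: nn_integral_minimizer[OF \<kappa>] kernel_0_slab)
    moreover have "emeasure (mixture kernel \<kappa>) ?A = (\<integral>\<^sup>+x. emeasure (kernel x) ?A \<partial>\<kappa>)"
      unfolding mixture_def using \<kappa>' prob_space.not_empty
      by (intro emeasure_bind[OF _ kernel_measurable_subprob A]) (auto simp: space_prob_algebra)
    ultimately show ?thesis by simp
  qed
  have mass_sum: "emeasure \<kappa> {0} + emeasure \<kappa> {u} = 1" if "\<kappa> \<in> minimizers p \<nu> kernel" for \<kappa>
    using nn_integral_minimizer[OF that, of "\<lambda>_. 1"] that
    by (auto simp: minimizers_def is_arg_min_def space_prob_algebra prob_space.emeasure_space_1)
  interpret K: prob_space "kernel u"
    using markov_kernel_kernel by (auto simp: markov_kernel_def space_prob_algebra)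
  \<comment> \<open>Cancellation in \<open>ennreal\<close> requires the half-space mass of
    \<open>kernel u\<close> to be both nonzero and finite.\<close>
  have u: "emeasure \<sigma> {u} = emeasure \<tau> {u}"
    using mass_u[OF \<sigma>] mass_u[OF \<tau>] eq kernel_u_slab K.emeasure_finite[of ?A]
    by (metis ennreal_mult_cancel_left less_irrefl infinity_ennreal_def)
  have "emeasure \<sigma> {u} \<le> 1"
    using mass_sum[OF \<sigma>] by (metis le_add_same_cancel2 zero_le add.commute le_iff_add)
  then have "emeasure \<sigma> {u} \<noteq> \<top>"
    by (auto simp: top_unique)
  then have 0: "emeasure \<sigma> {0} = emeasure \<tau> {0}"
    using mass_sum[OF \<sigma>] mass_sum[OF \<tau>] u
    by (metis add.commute ennreal_add_left_cancel infinity_ennreal_def)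
  have sets: "sets \<sigma> = sets borel" "sets \<tau> = sets borel"
    using \<sigma> \<tau> by (auto simp: minimizers_def is_arg_min_def space_prob_algebra)
  show "\<sigma> = \<tau>"
  proof (rule measure_eqI)
    fix B assume "B \<in> sets \<sigma>"
    then have B: "B \<in> sets borel" "B \<in> sets \<sigma>" "B \<in> sets \<tau>"
      using sets by auto
    then have "(indicator B :: 'x \<Rightarrow> ennreal) \<in> borel_measurable borel"
      by simp
    then show "emeasure \<sigma> B = emeasure \<tau> B"
      using nn_integral_minimizer[OF \<sigma>] nn_integral_minimizer[OF \<tau>] B u 0
      by (metis nn_integral_indicator)
  qed (simp add: sets)
qed

section \<open>Feasibility and non-uniqueness\<close>

lemma feasible_kernel: "feasible p \<nu> kernel"
proof -
  have "return borel 0 \<in> (borel_probs :: 'x measure set)"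
    by (simp add: space_prob_algebra prob_space_return)
  then have "(INF \<sigma> \<in> (borel_probs :: 'x measure set). wasserstein_powr p (mixture kernel \<sigma>) \<nu>) \<le> 1"
    using wasserstein_mixture_return[of 0] by (metis INF_lower)
  then show ?thesis
    unfolding feasible_def using le_less_trans by fastforce
qed

lemma minimizers_not_unique: "\<exists>\<sigma>\<in>minimizers p \<nu> kernel. \<exists>\<tau>\<in>minimizers p \<nu> kernel. \<sigma> \<noteq> \<tau>"
proof -
  have "(return borel 0 :: 'x measure) \<noteq> return borel u"
  proof
    assume "(return borel 0 :: 'x measure) = return borel u"
    then have "emeasure (return borel 0) {0::'x} = emeasure (return borel u) {0::'x}"
      by simp
    then show False
      using norm_u by (auto simp: indicator_def split: if_splits)
  qed
  then show ?thesis
    using return_in_minimizers by blast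
qed

lemma kernel_properties:
  "markov_kernel kernel \<and> narrowly_continuous kernel \<and> moment_coercive p kernel \<and>
   injective_on_minimizers p \<nu> kernel \<and> feasible p \<nu> kernel \<and>
   (\<exists>\<sigma>\<in>minimizers p \<nu> kernel. \<exists>\<tau>\<in>minimizers p \<nu> kernel. \<sigma> \<noteq> \<tau>)"
  using markov_kernel_kernel narrowly_continuous_kernel moment_coercive_kernel
    injective_on_minimizers_kernel feasible_kernel minimizers_not_unique by blast

end

section \<open>The Dirac example for exponent 2\<close>

lemma displaced_noise_dirac:
  fixes e :: "'y::euclidean_space" and u :: "'x::euclidean_space"
  assumes "norm e = 1" "norm u = 1"
  shows "displaced_noise 2 (return borel 0) e (\<lambda>y. ennreal (norm y powr 2)) u"
proof
  show "return borel 0 \<in> (borel_probs_moment 2 :: 'y measure set)"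
    by (simp add: borel_probs_moment_def space_prob_algebra prob_space_return moment_def
        nn_integral_return)
  \<comment> \<open>The inequality fails for \<open>y \<noteq> 0\<close> (take
    \<open>y' = 2 *\<^sub>R y\<close>), but such \<open>y\<close> form a null set of the Dirac mass;
    at \<open>y = 0\<close> it is an equality.\<close>
  show "AE y in return borel 0. \<forall>y'. ennreal (norm (y' :: 'y) powr 2)
      \<le> ennreal (norm (y' - y) powr 2) + ennreal (norm y powr 2)"
    by (rule AE_I'[of "- {0}"]) (auto simp: null_sets_def)
  show "AE y in return borel 0. \<forall>s\<ge>0. ennreal (norm (y + s *\<^sub>R e) powr 2)
      = ennreal (norm y powr 2) + ennreal (s powr 2)"
    by (rule AE_I'[of "- {0}"]) (auto simp: null_sets_def assms)
  show "AE y in return borel 0. 0 \<le> y \<bullet> e \<and> y \<bullet> e < 1"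
    by (subst AE_return) auto
qed (use assms in auto)

text \<open>A singleton is Lebesgue-null yet carries the whole Dirac mass.\<close>

lemma not_absolutely_continuous_dirac:
  "\<not> absolutely_continuous lborel (return borel (x :: 'a::euclidean_space))"
proof
  assume "absolutely_continuous lborel (return borel x)"
  moreover have "{x} \<in> null_sets lborel"
    by (simp add: null_sets_def)
  ultimately have "{x} \<in> null_sets (return borel x)"
    by (auto simp: absolutely_continuous_def)
  then show False
    by (simp add: null_sets_def)
qed

section \<open>The uniform example on the cube for exponent 1\<close>

definition unit_cube :: "'a::euclidean_space set" where
  "unit_cube = box 0 One"

lemma emeasure_unit_cube: "emeasure lborel (unit_cube :: 'a::euclidean_space set) = 1"
  by (simp add: unit_cube_def)

text \<open>The coordinate along the unit vector \<open>e\<close> is 1-Lipschitz and grows by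
  exactly \<open>s\<close> under a shift by \<open>s *\<^sub>R e\<close>, so for exponent 1 it is a
  tight potential at every point of the cube.\<close>

lemma displaced_noise_cube:
  fixes e :: "'y::euclidean_space" and u :: "'x::euclidean_space"
  assumes e: "e \<in> Basis" and u: "norm u = 1"
  shows "displaced_noise 1 (uniform_measure lborel unit_cube) e (\<lambda>y. ennreal (y \<bullet> e)) u"
proof -
  let ?\<nu> = "uniform_measure lborel (unit_cube :: 'y set)"
  have cube[measurable]: "(unit_cube :: 'y set) \<in> sets borel"
    by (simp add: unit_cube_def)
  have norm_e: "norm e = 1"
    using e by simp
  have prob: "prob_space ?\<nu>"
    by (intro prob_space_uniform_measure) (auto simp: emeasure_unit_cube)
  have AE_cube: "AE y in ?\<nu>. y \<in> unit_cube"
    by (intro AE_uniform_measureI) auto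
  then have slab: "AE y in ?\<nu>. 0 \<le> y \<bullet> e \<and> y \<bullet> e < 1"
    by eventually_elim (use e in \<open>auto simp: unit_cube_def mem_box intro: less_imp_le\<close>)
  have "bounded (unit_cube :: 'y set)"
    by (simp add: unit_cube_def)
  then obtain B where B: "\<And>y :: 'y. y \<in> unit_cube \<Longrightarrow> norm y \<le> B"
    by (auto simp: bounded_iff)
  show ?thesis
  proof
    have "moment 1 ?\<nu> \<le> (\<integral>\<^sup>+y. ennreal B \<partial>?\<nu>)"
      unfolding moment_def
      by (intro nn_integral_mono_AE) (use AE_cube in eventually_elim, auto intro!: ennreal_leI B)
    also have "\<dots> < \<infinity>"
      using prob_space.emeasure_space_1[OF prob] by simp
    finally show "?\<nu> \<in> borel_probs_moment 1"
      using prob by (simp add: borel_probs_moment_def space_prob_algebra)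
    have le_norm: "y \<bullet> e \<le> norm y" for y
      using norm_cauchy_schwarz[of y e] norm_e by simp
    then show "ennreal (y \<bullet> e) \<le> ennreal (norm y powr 1)" for y
      by (simp add: ennreal_leI)
    show "AE y in ?\<nu>. \<forall>y'. ennreal (y' \<bullet> e) \<le> ennreal (norm (y' - y) powr 1) + ennreal (y \<bullet> e)"
      using slab
    proof eventually_elim
      case (elim y)
      \<comment> \<open>A negative \<open>y' \<bullet> e\<close> is truncated to 0, which
        monotonicity of \<open>ennreal\<close> absorbs; \<open>y \<bullet> e \<ge> 0\<close> from
        the slab allows the right side to be split.\<close>
      have "ennreal (y' \<bullet> e) \<le> ennreal (norm (y' - y) + y \<bullet> e)" for y'
        using le_norm[of "y' - y"] by (intro ennreal_leI) (simp add: inner_diff_left)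
      then show ?case
        using elim by (simp add: ennreal_plus)
    qed
    show "AE y in ?\<nu>. \<forall>s\<ge>0. ennreal ((y + s *\<^sub>R e) \<bullet> e) = ennreal (y \<bullet> e) + ennreal (s powr 1)"
      using slab by eventually_elim
        (use e in \<open>auto simp: inner_add_left ennreal_plus\<close>)
  qed (use slab norm_e u in auto)
qed

section \<open>Existence of both examples\<close>

theorem proposition2p5:
  shows
   "(\<exists>(\<nu> :: (real ^ 'd) measure) (\<rho> :: real ^ 'e \<Rightarrow> (real ^ 'd) measure).
       \<nu> \<in> borel_probs_moment 2 \<and>
       \<not> absolutely_continuous lborel \<nu> \<and>
       markov_kernel \<rho> \<and>
       narrowly_continuous \<rho> \<and>
       moment_coercive 2 \<rho> \<and>
       injective_on_minimizers 2 \<nu> \<rho> \<and>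
       feasible 2 \<nu> \<rho> \<and>
       (\<exists>\<sigma> \<in> minimizers 2 \<nu> \<rho>. \<exists>\<tau> \<in> minimizers 2 \<nu> \<rho>. \<sigma> \<noteq> \<tau>)) \<and>
    (\<exists>(\<nu> :: (real ^ 'd) measure) (\<rho> :: real ^ 'e \<Rightarrow> (real ^ 'd) measure).
       \<nu> \<in> borel_probs_moment 1 \<and>
       absolutely_continuous lborel \<nu> \<and>
       markov_kernel \<rho> \<and>
       narrowly_continuous \<rho> \<and>
       moment_coercive 1 \<rho> \<and>
       injective_on_minimizers 1 \<nu> \<rho> \<and>
       feasible 1 \<nu> \<rho> \<and>
       (\<exists>\<sigma> \<in> minimizers 1 \<nu> \<rho>. \<exists>\<tau> \<in> minimizers 1 \<nu> \<rho>. \<sigma> \<noteq> \<tau>))"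
proof -
  \<comment> \<open>The cube example needs \<open>e\<close> to be a coordinate direction; of
    \<open>u\<close> only its length matters.\<close>
  obtain e :: "real ^ 'd" where e: "e \<in> Basis" "norm e = 1"
    using nonempty_Basis norm_Basis by blast
  obtain u :: "real ^ 'e" where u: "norm u = 1"
    using nonempty_Basis norm_Basis by blast
  interpret dirac: displaced_noise 2 "return borel 0" e "\<lambda>y. ennreal (norm y powr 2)" u
    by (rule displaced_noise_dirac[OF e(2) u])
  interpret cube: displaced_noise 1 "uniform_measure lborel unit_cube" e "\<lambda>y. ennreal (y \<bullet> e)" u
    by (rule displaced_noise_cube[OF e(1) u])
  have "absolutely_continuous lborel (uniform_measure lborel (unit_cube :: (real ^ 'd) set))"
    unfolding uniform_measure_def
    by (intro absolutely_continuousI_density) (simp add: unit_cube_def)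
  then show ?thesis
    using dirac.\<nu>_moment not_absolutely_continuous_dirac dirac.kernel_properties
      cube.\<nu>_moment cube.kernel_properties by blast
qed

end
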